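(* Let $n\ge 3$, let $b_1,\dots,b_n\in\mathbb{R}$, and let $\theta,\phi\in[0,1)$. Let $\mathbf{S}_n(\theta)$ be the discrete Schrödinger matrix with diagonal entries $b_1,\dots,b_n$ and Floquet boundary conditions of angle $\theta$, and let $\mathbf{F}_n(\phi)$ be the free discrete Schrödinger matrix with Floquet boundary conditions of angle $\phi$. Suppose that $\mathbf{S}_n(\theta)$ shares all of its eigenvalues with $\mathbf{F}_n(\phi)$, including multiplicity. Then $b_1=\cdots=b_n=0$, and $\theta=\phi$ or $\theta=1-\phi$; that is, $\mathbf{S}_n(\theta)=\mathbf{F}_n(\phi)$ or $\mathbf{S}_n(\theta)=\mathbf{F}_n(\phi)^{\mathsf{T}}$.
   Context: For $b_1,\dots,b_n\in\mathbb{R}$ and $\theta\in[0,1)$, $\mathbf{S}_n(\theta)$ is the $n\times n$ Hermitian matrix with $(k,k)$ entry $b_k$ for $1\le k\le n$, with $(k,k+1)$ and $(k+1,k)$ entries equal to $1$ for $1\le k\le n-1$, with $(1,n)$ entry $e^{2\pi i\theta}$, with $(n,1)$ entry $e^{-2\pi i\theta}$, and with all other entries $0$. $\mathbf{F}_n(\phi)$ is the matrix of this form with angle $\phi$ and all diagonal entries equal to $0$. The superscript $\mathsf{T}$ denotes the (non-conjugated) transpose. *)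

theory Defs
  imports Complex_Main "Jordan_Normal_Form.Char_Poly"
begin

(* Rows and columns of type "mat" are indexed from 0, the diagonal b from 1.
   For n \<ge> 3, the only sizes considered, the corner positions (0, n - 1) and (n - 1, 0)
   lie neither on the diagonal nor next to it, so the order of the cases is irrelevant. *)
definition floquet_schroedinger :: "nat \<Rightarrow> (nat \<Rightarrow> real) \<Rightarrow> real \<Rightarrow> complex mat" where
  "floquet_schroedinger n b \<theta> = mat n n (\<lambda>(i, j).
     if i = j then complex_of_real (b (i + 1))
     else if j = i + 1 \<or> i = j + 1 then 1
     else if i = 0 \<and> j = n - 1 then exp (2 * complex_of_real pi * \<i> * complex_of_real \<theta>)
     else if i = n - 1 \<and> j = 0 then exp (- (2 * complex_of_real pi * \<i> * complex_of_real \<theta>))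
     else 0)"

definition free_floquet_schroedinger :: "nat \<Rightarrow> real \<Rightarrow> complex mat" where
  "free_floquet_schroedinger n \<phi> = floquet_schroedinger n (\<lambda>_. 0) \<phi>"

(* Algebraic multiplicity; the matrices above are Hermitian, so it agrees with the
   dimension of the eigenspace. *)
definition eigenvalue_multiplicity :: "complex mat \<Rightarrow> complex \<Rightarrow> nat" where
  "eigenvalue_multiplicity A x = Polynomial.order x (char_poly A)"

definition same_eigenvalues_with_multiplicity :: "complex mat \<Rightarrow> complex mat \<Rightarrow> bool" where
  "same_eigenvalues_with_multiplicity A B \<longleftrightarrow>
     (\<forall>x. eigenvalue A x \<longleftrightarrow> eigenvalue B x) \<and>
     (\<forall>x. eigenvalue A x \<longrightarrow> eigenvalue_multiplicity A x = eigenvalue_multiplicity B x)"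

end

theory Submission
  imports Defs "Jordan_Normal_Form.Schur_Decomposition"
begin

text \<open>
  The trace of \<open>S\<^sup>2\<close> is a function of the spectrum, and it exceeds the trace of the square of the
  free matrix by \<open>\<Sum>k. b\<^sub>k\<^sup>2\<close>; hence \<open>b = 0\<close>. The free matrix of angle \<open>\<theta>\<close> has the eigenvalue
  \<open>\<omega> + 1/\<omega>\<close> with \<open>\<omega> = e\<^bsup>-2\<pi>i\<theta>/n\<^esup>\<close>. For an eigenvector \<open>v\<close> of the free matrix of angle \<open>\<phi>\<close> with
  this eigenvalue, extended by \<open>v\<^bsub>k+n\<^esub> = e\<^bsup>-2\<pi>i\<phi>\<^esup> v\<^sub>k\<close>, the differences \<open>v\<^bsub>k+1\<^esub> - \<omega> v\<^sub>k\<close> form a geometric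
  sequence of ratio \<open>1/\<omega>\<close>. If they do not vanish, then \<open>\<omega>\<^sup>n = e\<^bsup>2\<pi>i\<phi>\<^esup>\<close>; otherwise \<open>v\<close> is geometric of
  ratio \<open>\<omega>\<close> and \<open>\<omega>\<^sup>n = e\<^bsup>-2\<pi>i\<phi>\<^esup>\<close>. So \<open>\<theta>\<close> is congruent to \<open>\<phi>\<close> or to \<open>-\<phi>\<close> modulo 1.
\<close>

section \<open>Traces of squares and the spectrum\<close>

definition mat_trace :: "'a::comm_monoid_add mat \<Rightarrow> 'a" where
  "mat_trace A = (\<Sum>i<dim_row A. A $$ (i, i))"

lemma mat_trace_mult:
  assumes "A \<in> carrier_mat n m" "B \<in> carrier_mat m n"
  shows "mat_trace (A * B) = (\<Sum>i<n. \<Sum>j<m. A $$ (i, j) * B $$ (j, i))"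
  using assms by (auto simp: mat_trace_def scalar_prod_def atLeast0LessThan intro!: sum.cong)

lemma mat_trace_mult_commute:
  fixes A B :: "'a::comm_semiring_0 mat"
  assumes "A \<in> carrier_mat n m" "B \<in> carrier_mat m n"
  shows "mat_trace (A * B) = mat_trace (B * A)"
  unfolding mat_trace_mult[OF assms] mat_trace_mult[OF assms(2,1)]
  by (subst sum.swap) (simp add: mult.commute)

lemma mat_trace_similar:
  fixes A B :: "'a::comm_semiring_1 mat"
  assumes "similar_mat_wit A B P Q"
  shows "mat_trace A = mat_trace B"
proof -
  define n where "n = dim_row A"
  from similar_mat_witD[OF n_def assms]
  have *: "A = P * B * Q" "Q * P = 1\<^sub>m n" "B \<in> carrier_mat n n" "P \<in> carrier_mat n n"
    "Q \<in> carrier_mat n n"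
    by auto
  have "mat_trace A = mat_trace (Q * (P * B))"
    unfolding *(1) using * by (intro mat_trace_mult_commute[of _ n n]) auto
  also have "Q * (P * B) = Q * P * B"
    using * by (intro assoc_mult_mat[symmetric, of _ n n _ n _ n]) auto
  also have "\<dots> = B"
    using * by simp
  finally show ?thesis .
qed

lemma mat_trace_square_upper_triangular:
  fixes B :: "'a::comm_semiring_1 mat"
  assumes "B \<in> carrier_mat n n" "upper_triangular B"
  shows "mat_trace (B * B) = (\<Sum>x\<leftarrow>diag_mat B. x ^ 2)"
proof -
  \<comment> \<open>For \<open>i\<close> \<noteq> \<open>j\<close>, one of the two factors lies
    strictly below the diagonal and vanishes.\<close>
  have "B $$ (i, j) * B $$ (j, i) = (if i = j then (B $$ (i, i)) ^ 2 else 0)"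
    if "i < n" "j < n" for i j
    using that assms upper_triangularD[OF assms(2), of i j] upper_triangularD[OF assms(2), of j i]
    by (cases i j rule: linorder_cases) (auto simp: power2_eq_square)
  hence "mat_trace (B * B) = (\<Sum>i<n. \<Sum>j<n. if i = j then (B $$ (i, i)) ^ 2 else 0)"
    unfolding mat_trace_mult[OF assms(1,1)] by (intro sum.cong) auto
  also have "\<dots> = (\<Sum>x\<leftarrow>diag_mat B. x ^ 2)"
    using assms(1) by (simp add: diag_mat_def interv_sum_list_conv_sum_set_nat atLeast0LessThan o_def)
  finally show ?thesis .
qed

text \<open>Schur triangularization puts \<open>es\<close> on the diagonal of \<open>B\<close>; the
  same \<open>P\<close> and \<open>Q\<close> conjugate \<open>A * A\<close> to \<open>B * B\<close>,
  and similarity preserves the trace.\<close>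

lemma mat_trace_square_eq_sum_eigenvalues:
  fixes A :: "complex mat"
  assumes A: "A \<in> carrier_mat n n" and es: "char_poly A = (\<Prod>e\<leftarrow>es. [:- e, 1:])"
  shows "mat_trace (A * A) = (\<Sum>e\<leftarrow>es. e ^ 2)"
proof -
  obtain B P Q where B: "schur_decomposition A es = (B, P, Q)"
    by (metis prod_cases3)
  from schur_decomposition[OF A es B]
  have sim: "similar_mat_wit A B P Q" and tri: "upper_triangular B" and diag: "diag_mat B = es"
    by auto
  from similar_mat_witD2[OF A sim] have Bc: "B \<in> carrier_mat n n" by auto
  from similar_mat_wit_pow[OF sim, of 2]
  have "similar_mat_wit (A * A) (B * B) P Q"
    using A Bc by (simp add: numeral_2_eq_2)
  from mat_trace_similar[OF this] show ?thesis
    using mat_trace_square_upper_triangular[OF Bc tri] diag by simp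
qed

text \<open>A monic complex polynomial is a product of linear factors over its roots, which is
  exactly where the hypothesis supplies the orders.\<close>

lemma char_poly_eq_if_same_eigenvalues:
  assumes A: "A \<in> carrier_mat n n" and B: "B \<in> carrier_mat n n"
    and same: "same_eigenvalues_with_multiplicity A B"
  shows "char_poly A = char_poly B"
proof -
  have roots: "poly (char_poly A) x = 0 \<longleftrightarrow> poly (char_poly B) x = 0" for x
    using same eigenvalue_root_char_poly[OF A] eigenvalue_root_char_poly[OF B]
    by (auto simp: same_eigenvalues_with_multiplicity_def)
  have order: "Polynomial.order x (char_poly A) = Polynomial.order x (char_poly B)"
    if "poly (char_poly B) x = 0" for x
    using same that roots eigenvalue_root_char_poly[OF A]
    by (auto simp: same_eigenvalues_with_multiplicity_def eigenvalue_multiplicity_def)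
  have "(\<Prod>z | poly (char_poly A) z = 0. [:- z, 1:] ^ Polynomial.order z (char_poly A)) =
        (\<Prod>z | poly (char_poly B) z = 0. [:- z, 1:] ^ Polynomial.order z (char_poly B))"
    by (intro prod.cong) (auto simp: roots order)
  thus ?thesis
    using complex_poly_decompose[of "char_poly A"] complex_poly_decompose[of "char_poly B"]
      degree_monic_char_poly[OF A] degree_monic_char_poly[OF B]
    by simp
qed

section \<open>Floquet matrices\<close>

lemma floquet_schroedinger_carrier: "floquet_schroedinger n b \<theta> \<in> carrier_mat n n"
  by (simp add: floquet_schroedinger_def)

lemma free_floquet_schroedinger_carrier: "free_floquet_schroedinger n \<phi> \<in> carrier_mat n n"
  by (simp add: free_floquet_schroedinger_def floquet_schroedinger_def)

text \<open>Off the diagonal, opposite entries multiply to 0 or 1 whatever the angle, the corner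
  entries being mutually inverse; so \<theta> and \<phi> may differ.\<close>

lemma mat_trace_floquet_square:
  "mat_trace (floquet_schroedinger n b \<theta> * floquet_schroedinger n b \<theta>) =
   complex_of_real (\<Sum>k=1..n. b k ^ 2) +
   mat_trace (free_floquet_schroedinger n \<phi> * free_floquet_schroedinger n \<phi>)"
proof -
  have entry: "floquet_schroedinger n b \<theta> $$ (i, j) * floquet_schroedinger n b \<theta> $$ (j, i) =
      (if i = j then complex_of_real (b (i + 1) ^ 2) else 0) +
      free_floquet_schroedinger n \<phi> $$ (i, j) * free_floquet_schroedinger n \<phi> $$ (j, i)"
    if "i < n" "j < n" for i j
    using that unfolding free_floquet_schroedinger_def floquet_schroedinger_def
    by (auto simp: power2_eq_square simp flip: exp_add)
  have "mat_trace (floquet_schroedinger n b \<theta> * floquet_schroedinger n b \<theta>) =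
      (\<Sum>i<n. complex_of_real (b (i + 1) ^ 2)) +
      mat_trace (free_floquet_schroedinger n \<phi> * free_floquet_schroedinger n \<phi>)"
    unfolding mat_trace_mult[OF floquet_schroedinger_carrier floquet_schroedinger_carrier]
      mat_trace_mult[OF free_floquet_schroedinger_carrier free_floquet_schroedinger_carrier]
    by (simp add: entry sum.distrib)
  also have "(\<Sum>i<n. complex_of_real (b (i + 1) ^ 2)) = complex_of_real (\<Sum>k=1..n. b k ^ 2)"
    unfolding of_real_sum
    by (rule sum.reindex_bij_witness[of _ "\<lambda>k. k - 1" "\<lambda>i. i + 1"]) auto
  finally show ?thesis .
qed

text \<open>The Floquet condition as twisted periodicity: \<open>u n\<close> and \<open>u (Suc n)\<close> stand for
  \<open>e\<^bsup>-2\<pi>i\<phi>\<^esup> u 0\<close> and \<open>e\<^bsup>-2\<pi>i\<phi>\<^esup> u 1\<close>.\<close>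

lemma free_floquet_mult_vec:
  assumes n: "n \<ge> 3"
    and un: "u n = exp (- (2 * complex_of_real pi * \<i> * complex_of_real \<phi>)) * u 0"
    and uSn: "u (Suc n) = exp (- (2 * complex_of_real pi * \<i> * complex_of_real \<phi>)) * u 1"
  shows "i < n \<Longrightarrow> i \<noteq> 0 \<Longrightarrow>
      (free_floquet_schroedinger n \<phi> *\<^sub>v vec n u) $ i = u (i - 1) + u (Suc i)"
    and "exp (- (2 * complex_of_real pi * \<i> * complex_of_real \<phi>)) *
      (free_floquet_schroedinger n \<phi> *\<^sub>v vec n u) $ 0 = u (n - 1) + u (Suc n)"
proof -
  let ?F = "free_floquet_schroedinger n \<phi>"
  have row: "(?F *\<^sub>v vec n u) $ i = (\<Sum>j<n. ?F $$ (i, j) * u j)" if "i < n" for i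
    using that free_floquet_schroedinger_carrier[of n \<phi>]
    by (auto simp: scalar_prod_def atLeast0LessThan intro!: sum.cong)
  have two: "(\<Sum>j<n. ?F $$ (i, j) * u j) = ?F $$ (i, p) * u p + ?F $$ (i, q) * u q"
    if "p < n" "q < n" "p \<noteq> q" "\<And>j. j < n \<Longrightarrow> j \<noteq> p \<Longrightarrow> j \<noteq> q \<Longrightarrow> ?F $$ (i, j) = 0" for i p q
  proof -
    have "(\<Sum>j<n. ?F $$ (i, j) * u j) = (\<Sum>j\<in>{p, q}. ?F $$ (i, j) * u j)"
      using that by (intro sum.mono_neutral_right) auto
    thus ?thesis using that by simp
  qed
  note F = free_floquet_schroedinger_def floquet_schroedinger_def
  show "(?F *\<^sub>v vec n u) $ i = u (i - 1) + u (Suc i)" if i: "i < n" "i \<noteq> 0"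
  proof (cases "i = n - 1")
    case True
    \<comment> \<open>The last row wraps around to column 0, where the corner entry turns
      \<open>u 0\<close> into \<open>u n\<close>.\<close>
    have "(?F *\<^sub>v vec n u) $ i = ?F $$ (i, i - 1) * u (i - 1) + ?F $$ (i, 0) * u 0"
      unfolding row[OF i(1)] using n i True by (intro two) (auto simp: F)
    also have "\<dots> = u (i - 1) + u n"
      using n True by (auto simp: F un)
    finally show ?thesis using True n by simp
  next
    case False
    have "(?F *\<^sub>v vec n u) $ i = ?F $$ (i, i - 1) * u (i - 1) + ?F $$ (i, Suc i) * u (Suc i)"
      unfolding row[OF i(1)] using n i False by (intro two) (auto simp: F)
    also have "\<dots> = u (i - 1) + u (Suc i)"
      using n i False by (auto simp: F)
    finally show ?thesis .
  qed
  \<comment> \<open>The exponential factor in the goal cancels the corner entry and turns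
    \<open>u 1\<close> into \<open>u (Suc n)\<close>, so row 0 becomes the recurrence at index
    \<open>n\<close>.\<close>
  have "(?F *\<^sub>v vec n u) $ 0 = ?F $$ (0, n - 1) * u (n - 1) + ?F $$ (0, 1) * u 1"
    using n by (subst row, simp, intro two) (auto simp: F)
  also have "\<dots> = exp (2 * complex_of_real pi * \<i> * complex_of_real \<phi>) * u (n - 1) + u 1"
    using n by (auto simp: F)
  finally have "(?F *\<^sub>v vec n u) $ 0 =
      exp (2 * complex_of_real pi * \<i> * complex_of_real \<phi>) * u (n - 1) + u 1" .
  moreover have "exp (- z) * (exp z * x + y) = x + exp (- z) * y" for x y z :: complex
    by (simp add: distrib_left exp_minus)
  ultimately show "exp (- (2 * complex_of_real pi * \<i> * complex_of_real \<phi>)) *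
      (?F *\<^sub>v vec n u) $ 0 = u (n - 1) + u (Suc n)"
    unfolding uSn by (simp only:)
qed

section \<open>Eigenvalues of the free matrix\<close>

text \<open>The geometric sequence of ratio \<omega> solves the three-term recurrence, and the
  condition on \<open>\<omega> ^ n\<close> is its twisted periodicity.\<close>

lemma free_floquet_eigenvalueI:
  assumes n: "n \<ge> 3" and w0: "\<omega> \<noteq> 0"
    and w: "\<omega> ^ n = exp (- (2 * complex_of_real pi * \<i> * complex_of_real \<theta>))"
  shows "eigenvalue (free_floquet_schroedinger n \<theta>) (\<omega> + inverse \<omega>)"
proof -
  let ?F = "free_floquet_schroedinger n \<theta>" and ?v = "vec n (\<lambda>k. \<omega> ^ k)"
  have dim: "dim_row ?F = n"
    using free_floquet_schroedinger_carrier[of n \<theta>] by simp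
  have geom: "\<omega> ^ (k - 1) + \<omega> ^ Suc k = (\<omega> + inverse \<omega>) * \<omega> ^ k" if "k \<noteq> 0" for k
    using that w0 by (cases k) (simp_all add: distrib_right mult.assoc[symmetric])
  have wn: "\<omega> ^ n = exp (- (2 * complex_of_real pi * \<i> * complex_of_real \<theta>)) * \<omega> ^ 0"
    and wSn: "\<omega> ^ Suc n = exp (- (2 * complex_of_real pi * \<i> * complex_of_real \<theta>)) * \<omega> ^ 1"
    unfolding w[symmetric] by simp_all
  note row = free_floquet_mult_vec[of n "\<lambda>k. \<omega> ^ k" \<theta>, OF n wn wSn, folded w]
  have "(?F *\<^sub>v ?v) $ i = (\<omega> + inverse \<omega>) * \<omega> ^ i" if i: "i < n" for i
  proof (cases "i = 0")
    case True
    \<comment> \<open>Row 0 is available only multiplied by \<open>\<omega> ^ n\<close>, a nonzero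
      factor that is cancelled afterwards.\<close>
    have "\<omega> ^ n * (?F *\<^sub>v ?v) $ 0 = (\<omega> + inverse \<omega>) * \<omega> ^ n"
      unfolding row(2) using n by (intro geom) simp
    hence "\<omega> ^ n * ((?F *\<^sub>v ?v) $ 0) = \<omega> ^ n * (\<omega> + inverse \<omega>)"
      by (simp only: mult.commute)
    thus ?thesis unfolding True mult_cancel_left using w0 by simp
  next
    case False
    show ?thesis unfolding row(1)[OF i False] using False by (rule geom)
  qed
  hence "?F *\<^sub>v ?v = (\<omega> + inverse \<omega>) \<cdot>\<^sub>v ?v"
    using dim by (intro eq_vecI) auto
  moreover have "?v \<noteq> 0\<^sub>v n"
  proof
    assume "?v = 0\<^sub>v n"
    hence "?v $ 0 = 0\<^sub>v n $ 0" by simp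
    thus False using n by simp
  qed
  ultimately have "eigenvector ?F ?v (\<omega> + inverse \<omega>)"
    by (auto simp: eigenvector_def dim)
  thus ?thesis unfolding eigenvalue_def by blast
qed

text \<open>The characteristic equation of the recurrence has roots \<omega> and
  \<open>inverse \<omega>\<close>. Splitting off one factor at a time avoids the general solution
  formula, which degenerates when the roots coincide.\<close>

lemma free_floquet_eigenvalueD:
  assumes n: "n \<ge> 3" and w0: "\<omega> \<noteq> 0"
    and ev: "eigenvalue (free_floquet_schroedinger n \<phi>) (\<omega> + inverse \<omega>)"
  shows "\<omega> ^ n = exp (2 * complex_of_real pi * \<i> * complex_of_real \<phi>) \<or>
         \<omega> ^ n = exp (- (2 * complex_of_real pi * \<i> * complex_of_real \<phi>))"
proof -
  let ?F = "free_floquet_schroedinger n \<phi>"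
  define c where "c = exp (- (2 * complex_of_real pi * \<i> * complex_of_real \<phi>))"
  have dim: "dim_row ?F = n"
    using free_floquet_schroedinger_carrier[of n \<phi>] by simp
  from ev obtain v where v: "v \<in> carrier_vec n" "v \<noteq> 0\<^sub>v n" "?F *\<^sub>v v = (\<omega> + inverse \<omega>) \<cdot>\<^sub>v v"
    unfolding eigenvalue_def eigenvector_def dim by auto
  \<comment> \<open>Only indices up to \<open>Suc n\<close> matter below.\<close>
  define u where "u k = (if k < n then v $ k else c * v $ (k - n))" for k
  have vu: "v = vec n u"
    using v(1) by (intro eq_vecI) (auto simp: u_def)
  have un: "u n = c * u 0" and uSn: "u (Suc n) = c * u 1"
    using n by (auto simp: u_def)
  note row = free_floquet_mult_vec[of n u \<phi>, OF n un[unfolded c_def] uSn[unfolded c_def],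
      folded vu c_def]
  have Fv: "(?F *\<^sub>v v) $ i = (\<omega> + inverse \<omega>) * u i" if "i < n" for i
    using that v by (simp add: u_def)
  \<comment> \<open>The recurrence is centred at \<open>Suc k\<close>, which runs through 1 to
    \<open>n\<close>; the centre \<open>n\<close> is row 0 multiplied by \<open>c\<close>.\<close>
  have rec: "u k + u (Suc (Suc k)) = (\<omega> + inverse \<omega>) * u (Suc k)" if "k < n" for k
  proof (cases "Suc k = n")
    case True
    have "u k + u (Suc (Suc k)) = c * (?F *\<^sub>v v) $ 0"
      unfolding row(2) using True by auto
    also have "\<dots> = (\<omega> + inverse \<omega>) * u n"
      using n by (subst Fv) (simp_all add: un)
    finally show ?thesis by (simp only: True)
  next
    case False
    with that have k: "Suc k < n" by simp
    show ?thesis using row(1)[OF k] unfolding Fv[OF k] by simp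
  qed
  define w where "w k = u (Suc k) - \<omega> * u k" for k
  have step: "w (Suc k) = inverse \<omega> * w k" if "k < n" for k
  proof -
    have "u (Suc (Suc k)) = (\<omega> + inverse \<omega>) * u (Suc k) - u k"
      using rec[OF that] by (simp add: algebra_simps)
    thus ?thesis using w0 by (simp add: w_def ring_distribs mult.assoc[symmetric])
  qed
  have w_geom: "w k = inverse \<omega> ^ k * w 0" if "k \<le> n" for k
    using that by (induction k) (auto simp: step)
  \<comment> \<open>\<open>w\<close> inherits the twisted periodicity of \<open>u\<close>;
    comparison with its geometric form determines \<open>\<omega> ^ n\<close> unless
    \<open>w 0\<close> vanishes.\<close>
  have "w n = c * w 0"
    by (simp add: w_def un uSn algebra_simps)
  with w_geom[OF order_refl] have wn: "inverse \<omega> ^ n * w 0 = c * w 0" by metis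
  show ?thesis
  proof (cases "w 0 = 0")
    case False
    with wn have "inverse (\<omega> ^ n) = c" by (simp add: power_inverse)
    hence "\<omega> ^ n = inverse c" by auto
    thus ?thesis by (simp add: c_def exp_minus)
  next
    case True
    have u_step: "u (Suc k) = \<omega> * u k" if "k \<le> n" for k
      using w_geom[OF that] True by (simp add: w_def)
    have u_geom: "u k = \<omega> ^ k * u 0" if "k \<le> n" for k
      using that by (induction k) (auto simp: u_step)
    have "u 0 \<noteq> 0"
    proof
      assume "u 0 = 0"
      hence "u k = 0" if "k < n" for k using u_geom[of k] that by simp
      hence "v = 0\<^sub>v n" unfolding vu by (intro eq_vecI) auto
      thus False using v(2) by contradiction
    qed
    with u_geom[of n] un have "\<omega> ^ n = c" by simp
    thus ?thesis by (simp add: c_def)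
  qed
qed

section \<open>Angles modulo 1\<close>

lemma exp_2pi_i_eq_iff:
  fixes x y :: real
  shows "exp (2 * complex_of_real pi * \<i> * complex_of_real x) =
         exp (2 * complex_of_real pi * \<i> * complex_of_real y) \<longleftrightarrow> (\<exists>k::int. x = y + k)"
proof -
  have exp_cis: "exp (2 * complex_of_real pi * \<i> * complex_of_real t) = cis (2 * pi * t)" for t
    by (simp add: cis_conv_exp mult_ac)
  have cis_1: "cis t = 1 \<longleftrightarrow> cos t = 1" for t
    by (auto simp: complex_eq_iff intro: cos_one_sin_zero)
  have "cis (2 * pi * x) = cis (2 * pi * y) \<longleftrightarrow> cis (2 * pi * (x - y)) = 1"
    by (simp add: right_diff_distrib flip: cis_divide)
  also have "\<dots> \<longleftrightarrow> (\<exists>k::int. 2 * pi * (x - y) = of_int k * 2 * pi)"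
    unfolding cis_1 cos_one_2pi_int ..
  also have "\<dots> \<longleftrightarrow> (\<exists>k::int. x = y + k)"
  proof (intro ex_cong1)
    fix k :: int
    have "2 * pi * (x - y) = of_int k * 2 * pi \<longleftrightarrow> 2 * pi * (x - y) = 2 * pi * of_int k"
      by (simp add: mult_ac)
    also have "\<dots> \<longleftrightarrow> x = y + k"
      unfolding mult_cancel_left by auto
    finally show "2 * pi * (x - y) = of_int k * 2 * pi \<longleftrightarrow> x = y + k" .
  qed
  finally show ?thesis unfolding exp_cis .
qed

lemma floquet_angle_eq:
  assumes n: "n \<ge> 3" and \<theta>: "\<theta> \<in> {0..<1}" and \<phi>: "\<phi> \<in> {0..<1}"
    and ev: "\<And>x. eigenvalue (free_floquet_schroedinger n \<theta>) x \<Longrightarrow>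
      eigenvalue (free_floquet_schroedinger n \<phi>) x"
  shows "\<theta> = \<phi> \<or> \<theta> = 1 - \<phi>"
proof -
  \<comment> \<open>An \<open>n\<close>-th root of the lower corner entry at angle \<theta>, as
    \<open>free_floquet_eigenvalueI\<close> requires.\<close>
  define \<omega> where "\<omega> = exp (- (2 * complex_of_real pi * \<i> * complex_of_real \<theta>) / of_nat n)"
  have wn: "\<omega> ^ n = exp (2 * complex_of_real pi * \<i> * complex_of_real (- \<theta>))"
    using n by (simp add: \<omega>_def flip: exp_of_nat_mult)
  have "eigenvalue (free_floquet_schroedinger n \<phi>) (\<omega> + inverse \<omega>)"
    using wn by (intro ev free_floquet_eigenvalueI n) (auto simp: \<omega>_def)
  from free_floquet_eigenvalueD[OF n _ this]
  have "\<omega> ^ n = exp (2 * complex_of_real pi * \<i> * complex_of_real \<phi>) \<or>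
      \<omega> ^ n = exp (2 * complex_of_real pi * \<i> * complex_of_real (- \<phi>))"
    by (simp add: \<omega>_def)
  then obtain k :: int where "- \<theta> = \<phi> + k \<or> - \<theta> = - \<phi> + k"
    unfolding wn exp_2pi_i_eq_iff by blast
  thus ?thesis
  proof
    \<comment> \<open>Here \<open>k = 0\<close> forces both angles to be 0, and
      \<open>k = - 1\<close> gives the reflected angle.\<close>
    assume *: "- \<theta> = \<phi> + k"
    hence "- 2 < real_of_int k" "real_of_int k \<le> 0" using \<theta> \<phi> by auto
    hence "k = 0 \<or> k = - 1" by linarith
    thus ?thesis using * \<theta> \<phi> by auto
  next
    assume *: "- \<theta> = - \<phi> + k"
    hence "- 1 < real_of_int k" "real_of_int k < 1" using \<theta> \<phi> by auto
    hence "k = 0" by linarith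
    thus ?thesis using * by simp
  qed
qed

text \<open>Transposition swaps the corner entries, which negates the angle, and 1 - \<phi> is
  congruent to -\<phi> modulo 1.\<close>

lemma free_floquet_reflect:
  assumes "n \<ge> 3"
  shows "free_floquet_schroedinger n (1 - \<phi>) = transpose_mat (free_floquet_schroedinger n \<phi>)"
proof -
  have "exp (2 * complex_of_real pi * \<i> * complex_of_real (1 - \<phi>)) =
      exp (2 * complex_of_real pi * \<i> * complex_of_real (- \<phi>))"
    unfolding exp_2pi_i_eq_iff by (intro exI[of _ 1]) simp
  hence *: "exp (2 * complex_of_real pi * \<i> * (1 - complex_of_real \<phi>)) =
      exp (- (2 * complex_of_real pi * \<i> * complex_of_real \<phi>))"
    by simp
  hence "exp (- (2 * complex_of_real pi * \<i> * (1 - complex_of_real \<phi>))) =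
      exp (2 * complex_of_real pi * \<i> * complex_of_real \<phi>)"
    by (metis exp_minus inverse_inverse_eq)
  with * show ?thesis
    using assms unfolding free_floquet_schroedinger_def floquet_schroedinger_def
    by (intro eq_matI) auto
qed

theorem theorem3p8:
  fixes n :: nat and b :: "nat \<Rightarrow> real" and \<theta> \<phi> :: real
  assumes "n \<ge> 3"
    and "\<theta> \<in> {0..<1}"
    and "\<phi> \<in> {0..<1}"
    and "same_eigenvalues_with_multiplicity
           (floquet_schroedinger n b \<theta>) (free_floquet_schroedinger n \<phi>)"
  shows "(\<forall>k\<in>{1..n}. b k = 0) \<and> (\<theta> = \<phi> \<or> \<theta> = 1 - \<phi>) \<and>
         (floquet_schroedinger n b \<theta> = free_floquet_schroedinger n \<phi> \<or>
          floquet_schroedinger n b \<theta> = transpose_mat (free_floquet_schroedinger n \<phi>))"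
proof -
  let ?S = "floquet_schroedinger n b \<theta>" and ?F = "free_floquet_schroedinger n \<phi>"
  note S = floquet_schroedinger_carrier[of n b \<theta>] and F = free_floquet_schroedinger_carrier[of n \<phi>]
  have cp: "char_poly ?S = char_poly ?F"
    using S F assms(4) by (rule char_poly_eq_if_same_eigenvalues)
  \<comment> \<open>By \<open>cp\<close>, one list of eigenvalues serves both matrices.\<close>
  obtain es where es: "char_poly ?F = (\<Prod>e\<leftarrow>es. [:- e, 1:])"
    using char_poly_factorized[OF F] by blast
  have "mat_trace (?S * ?S) = mat_trace (?F * ?F)"
    using mat_trace_square_eq_sum_eigenvalues[OF S es[folded cp]]
      mat_trace_square_eq_sum_eigenvalues[OF F es] by simp
  hence "complex_of_real (\<Sum>k=1..n. b k ^ 2) = 0"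
    unfolding mat_trace_floquet_square[of n b \<theta> \<phi>] by simp
  hence "(\<Sum>k=1..n. b k ^ 2) = 0"
    by (simp only: of_real_eq_0_iff)
  hence b: "\<forall>k\<in>{1..n}. b k = 0"
    by (subst (asm) sum_nonneg_eq_0_iff) auto
  hence S_free: "?S = free_floquet_schroedinger n \<theta>"
    unfolding free_floquet_schroedinger_def floquet_schroedinger_def by (intro eq_matI) auto
  \<comment> \<open>Both matrices are now free, so their spectra determine the relation between the
    angles.\<close>
  have angle: "\<theta> = \<phi> \<or> \<theta> = 1 - \<phi>"
    using assms(4) unfolding S_free same_eigenvalues_with_multiplicity_def
    by (intro floquet_angle_eq[OF assms(1-3)]) blast
  show ?thesis
    using b angle S_free free_floquet_reflect[OF assms(1), of \<phi>] by auto
qed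

end
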